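(* There are infinitely many triples $(a,b,c)$ of positive integers, each greater than $1$, such that $ab+1$, $ac+1$, $bc+1$ and $abc+1$ are all perfect squares. *)

theory Defs
  imports "HOL-Computational_Algebra.Nth_Powers"
begin

end

theory Submission
  imports Defs
begin

text \<open>
  If \<open>a b + 1 = r\<^sup>2\<close> and \<open>c = a + b + 2 r\<close>, then \<open>a c + 1 = (a + r)\<^sup>2\<close> and
  \<open>b c + 1 = (b + r)\<^sup>2\<close>. Numerical search for triples of this kind with \<open>a b c + 1\<close> a square
  suggests \<open>a = k\<^sup>2 + 4\<close> and \<open>r = j a - h\<close>, where \<open>h = 2 j + 1 - k\<close> and
  \<open>h\<^sup>2 = 3 k\<^sup>2 + 13\<close>. This Pell-type equation makes \<open>r\<^sup>2 - 1\<close> divisible by \<open>a\<close>, and modulo it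
  \<open>a b c + 1\<close> is the square of a polynomial in \<open>j\<close> and \<open>k\<close>. Its solution \<open>(j, k) = (2, 1)\<close>
  gives the triple \<open>(5, 7, 24)\<close>, and multiplying \<open>h + k \<surd>3\<close> by \<open>2 + \<surd>3\<close> gives infinitely many
  others.
\<close>

text \<open>The equation \<open>h\<^sup>2 = 3 k\<^sup>2 + 13\<close> after substituting \<open>h = 2 j + 1 - k\<close>.\<close>

definition pell_pair :: "nat \<Rightarrow> nat \<Rightarrow> bool" where
  "pell_pair j k \<longleftrightarrow> 2 * j\<^sup>2 + 2 * j = k\<^sup>2 + 6 + k * (2 * j + 1)"

text \<open>Multiplication by 2 + sqrt 3 sends \<open>(h, k)\<close> to
  \<open>(2 h + 3 k, h + 2 k)\<close>; solving \<open>h = 2 j + 1 - k\<close> for \<open>j\<close>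
  turns this into the map below.\<close>

lemma pell_pair_step:
  assumes "pell_pair j k"
  shows "pell_pair (k + 3 * j + 1) (k + 2 * j + 1)"
  using assms by (simp add: pell_pair_def power2_eq_square algebra_simps)

lemma pell_pair_unbounded: "\<exists>j k. pell_pair j k \<and> j > 0 \<and> k > n"
proof (induction n)
  case 0
  have "pell_pair 2 1"
    by (simp add: pell_pair_def)
  then show ?case
    by (metis zero_less_one zero_less_numeral)
next
  case (Suc n)
  then obtain j k where "pell_pair j k" "j > 0" "k > n"
    by blast
  then show ?case
    by (intro exI[of _ "k + 3 * j + 1"] exI[of _ "k + 2 * j + 1"])
      (simp add: pell_pair_step[simplified])
qed

lemma is_square_int_imp_nat:
  assumes "int n = x\<^sup>2"
  shows "is_square n"
proof -
  have "int n = int ((nat \<bar>x\<bar>)\<^sup>2)"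
    using assms by simp
  then have "n = (nat \<bar>x\<bar>)\<^sup>2"
    by (simp only: of_nat_eq_iff)
  then show ?thesis
    by (simp add: is_nth_power_def)
qed

lemma pell_pair_triple:
  assumes "pell_pair j k" "j > 0" "k > 0"
  obtains b c where "b > 1" "c > 1"
    "is_square ((k\<^sup>2 + 4) * b + 1)" "is_square ((k\<^sup>2 + 4) * c + 1)"
    "is_square (b * c + 1)" "is_square ((k\<^sup>2 + 4) * b * c + 1)"
proof -
  \<comment> \<open>Let \<open>a = k^2 + 4\<close> and \<open>r = j a - h\<close>. Since
    \<open>h^2 - 1 = 3 a\<close>, the quotient \<open>(r^2 - 1) / a\<close> is
    \<open>j^2 a - 2 j h + 3\<close>, which expands to \<open>b\<close>; \<open>c\<close> is
    \<open>a + b + 2 r\<close> expanded.\<close>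
  define b where "b = (j * k)\<^sup>2 + 2 * j * (k - 1) + 3"
  define c where "c = ((j + 1) * k + 1)\<^sup>2 + 2 * j + 4"
  define J K where "J = int j" and "K = int k"
  define r where "r = J * K\<^sup>2 + 2 * J + K - 1"
  define t where "t = (J\<^sup>2 + J + 1) * K ^ 3 + (4 * J + 2) * K\<^sup>2 + 7 * K + 2 * J + 1"
  have rel: "2 * J\<^sup>2 + 2 * J = K\<^sup>2 + 6 + K * (2 * J + 1)"
    using arg_cong[OF assms(1)[unfolded pell_pair_def], of int]
    by (simp add: J_def K_def algebra_simps)
  have b: "int b = (J * K)\<^sup>2 + 2 * J * (K - 1) + 3"
    using assms(3) by (simp add: b_def J_def K_def of_nat_diff)
  have c: "int c = ((J + 1) * K + 1)\<^sup>2 + 2 * J + 4"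
    by (simp add: c_def J_def K_def algebra_simps)
  have ab: "(K\<^sup>2 + 4) * int b + 1 = r\<^sup>2"
    using rel unfolding b r_def by algebra
  have c': "int c = K\<^sup>2 + 4 + int b + 2 * r"
    unfolding b c r_def by algebra
  have ac: "(K\<^sup>2 + 4) * int c + 1 = (K\<^sup>2 + 4 + r)\<^sup>2"
    using ab c' by algebra
  have bc: "int b * int c + 1 = (int b + r)\<^sup>2"
    using ab c' by algebra
  have abc: "(K\<^sup>2 + 4) * int b * int c + 1
      = t\<^sup>2"
    using rel unfolding b c t_def by algebra
  show thesis
  proof
    show "b > 1" "c > 1"
      by (simp_all add: b_def c_def)
    show "is_square ((k\<^sup>2 + 4) * b + 1)"
      using ab by (intro is_square_int_imp_nat[of _ r]) (simp add: K_def)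
    show "is_square ((k\<^sup>2 + 4) * c + 1)"
      using ac by (intro is_square_int_imp_nat[of _ "K\<^sup>2 + 4 + r"]) (simp add: K_def)
    show "is_square (b * c + 1)"
      using bc by (intro is_square_int_imp_nat[of _ "int b + r"]) simp
    show "is_square ((k\<^sup>2 + 4) * b * c + 1)"
      using abc by (intro is_square_int_imp_nat[of _ t]) (simp add: K_def)
  qed
qed

theorem theorem1:
  shows "infinite {(a, b, c) :: nat \<times> nat \<times> nat | a b c.
           a > 1 \<and> b > 1 \<and> c > 1 \<and>
           is_square (a * b + 1) \<and> is_square (a * c + 1) \<and>
           is_square (b * c + 1) \<and> is_square (a * b * c + 1)}"
    (is "infinite ?S")
proof -
  \<comment> \<open>Unbounded first components \<open>k^2 + 4\<close> suffice for
    infinitude.\<close>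
  have "\<exists>a>n. a \<in> fst ` ?S" for n
  proof -
    obtain j k where jk: "pell_pair j k" "j > 0" "k > n"
      using pell_pair_unbounded by blast
    then have "k > 0"
      by simp
    from pell_pair_triple[OF jk(1,2) this] obtain b c where
      "b > 1" "c > 1"
      "is_square ((k\<^sup>2 + 4) * b + 1)" "is_square ((k\<^sup>2 + 4) * c + 1)"
      "is_square (b * c + 1)" "is_square ((k\<^sup>2 + 4) * b * c + 1)" .
    then have "(k\<^sup>2 + 4, b, c) \<in> ?S"
      by simp
    then have "k\<^sup>2 + 4 \<in> fst ` ?S"
      by (metis (no_types, lifting) fst_conv imageI)
    moreover have "k\<^sup>2 + 4 > n"
      using jk(3) self_le_power[of k 2] by simp
    ultimately show ?thesis
      by blast
  qed
  then have "infinite (fst ` ?S)"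
    by (meson finite_nat_set_iff_bounded less_asym)
  then show ?thesis
    by (rule contrapos_nn) (rule finite_imageI)
qed

end
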